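(* Let $X$ be a complex Fréchet space, let $T:X\to X$ be a continuous linear operator, and let $(\lambda_n)_n$ be a sequence of nonzero complex numbers such that $\frac{\lambda_{n+\tau}}{\lambda_n}\to 1$ as $n\to\infty$ for some integer $\tau\ge 1$. If $(\lambda_nT^n)_n$ has property $\mathcal{P}_{\overline{\mathcal{AP}}}$, then $T$ has property $\mathcal{P}_{\overline{\mathcal{AP}}}$.
   Context: An arithmetic progression of length $m+1$ and step $k\ge 1$ is a set $\{a,a+k,\dots,a+mk\}\subseteq\mathbb{N}$. $\overline{\mathcal{AP}}$ is the family of all $A\subseteq\mathbb{N}$ such that for every $m$ there is $k\ge 1$ such that $A$ contains infinitely many arithmetic progressions of step $k$ and length $m$. A sequence of operators $(T_n)_n$ on $X$ has property $\mathcal{P}_{\overline{\mathcal{AP}}}$ if for each nonempty open set $U\subseteq X$ there exists $x\in X$ such that $\{n\in\mathbb{N}: T_n x\in U\}\in\overline{\mathcal{AP}}$. An operator $T$ has property $\mathcal{P}_{\overline{\mathcal{AP}}}$ if the sequence $(T^n)_n$ does. *)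

theory Defs
  imports "HOL-Analysis.Analysis"
begin

definition complex_convex :: "(complex \<Rightarrow> 'a::ab_group_add \<Rightarrow> 'a) \<Rightarrow> 'a set \<Rightarrow> bool" where
  "complex_convex smul S \<longleftrightarrow>
     (\<forall>x\<in>S. \<forall>y\<in>S. \<forall>t::real. 0 \<le> t \<and> t \<le> 1 \<longrightarrow>
        smul (complex_of_real (1 - t)) x + smul (complex_of_real t) y \<in> S)"

text \<open>
  A complex Frechet space: a locally convex topological vector space over the complex numbers
  whose topology is induced by some complete translation-invariant metric. The underlying space
  is the whole type, with the topology given by its type class; the metric is not part of the
  structure, and the Hausdorff property follows from its existence.
\<close>

locale complex_frechet_space = vector_space smul
  for smul :: "complex \<Rightarrow> 'a::topological_ab_group_add \<Rightarrow> 'a" +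
  assumes continuous_smul: "continuous_on UNIV (\<lambda>(c, x). smul c x)"
    and locally_convex:
      "\<And>U. open U \<Longrightarrow> 0 \<in> U \<Longrightarrow> \<exists>V. open V \<and> 0 \<in> V \<and> V \<subseteq> U \<and> complex_convex smul V"
    and complete_invariant_metric:
      "\<exists>d. Metric_space (UNIV :: 'a set) d \<and>
           Metric_space.mtopology (UNIV :: 'a set) d = euclidean \<and>
           Metric_space.mcomplete (UNIV :: 'a set) d \<and>
           (\<forall>x y z. d (x + z) (y + z) = d x y)"

definition arith_prog :: "nat \<Rightarrow> nat \<Rightarrow> nat \<Rightarrow> nat set" where
  "arith_prog a k m = {a + j * k | j. j \<le> m}"

text \<open>
  The set \<^term>\<open>arith_prog a k m\<close> is the progression of step \<open>k\<close> starting at \<open>a\<close> whose length is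
  \<open>m + 1\<close>, not \<open>m\<close>. There is no progression of length zero, so letting \<open>m\<close> range over all natural
  numbers below covers exactly the possible lengths.
\<close>

definition AP_bar :: "nat set set" where
  "AP_bar = {A. \<forall>m. \<exists>k\<ge>1. infinite {P. (\<exists>a. P = arith_prog a k m) \<and> P \<subseteq> A}}"

definition seq_has_property ::
    "nat set set \<Rightarrow> (nat \<Rightarrow> 'a::topological_space \<Rightarrow> 'a) \<Rightarrow> bool" where
  "seq_has_property F Ts \<longleftrightarrow>
     (\<forall>U. open U \<and> U \<noteq> {} \<longrightarrow> (\<exists>x. {n. Ts n x \<in> U} \<in> F))"

definition has_property :: "nat set set \<Rightarrow> ('a::topological_space \<Rightarrow> 'a) \<Rightarrow> bool" where
  "has_property F T \<longleftrightarrow> seq_has_property F (\<lambda>n. T ^^ n)"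

end

theory Submission
  imports Defs
begin

text \<open>
  The link between \<open>(\<lambda>\<^sub>n T\<^sup>n)\<close> and \<open>T\<close> is topological multiple recurrence: every nonempty open set
  contains, for each \<open>m\<close>, a point that returns to it at the times \<open>k, 2k, \<dots>, mk\<close> for some
  \<open>k \<ge> 1\<close>.

  Suppose that \<open>\<lambda>\<^sub>n T\<^sup>n x\<close> lies in an open set for all \<open>n\<close> in a progression with first term \<open>a\<close> and
  step \<open>k\<close>. Then \<open>y = \<lambda>\<^sub>a T\<^sup>a x\<close> satisfies
  \<open>T\<^sup>j\<^sup>k y = (\<lambda>\<^sub>a / \<lambda>\<^sub>a\<^sub>+\<^sub>j\<^sub>k) (\<lambda>\<^sub>a\<^sub>+\<^sub>j\<^sub>k T\<^sup>a\<^sup>+\<^sup>j\<^sup>k x)\<close>. If \<open>\<tau>\<close> divides the step, the scalar factor tends to \<open>1\<close>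
  as \<open>a\<close> grows, so that joint continuity of scalar multiplication keeps \<open>T\<^sup>j\<^sup>k y\<close> in a
  slightly larger prescribed open set. Two features of \<open>AP_bar\<close> make this possible:
  infinitely many progressions of the same step allow \<open>a\<close> to be arbitrarily large, and arbitrary
  length allows passing to every \<open>\<tau>\<close>-th term. Hence \<open>T\<close> is multiply recurrent
  (\<open>multiply_recurrent_of_weighted_powers\<close>).

  Multiple recurrence in turn gives single points whose return times belong to \<open>AP_bar\<close>, for
  any continuous map on a completely metrizable space (\<open>has_property_AP_bar_if_recurrent\<close>).
  Iterate multiple recurrence along shrinking balls: the ball \<open>B\<^sub>n\<^sub>+\<^sub>1\<close> is chosen such that its
  points lie in \<open>B\<^sub>n\<close> at the times \<open>0, k\<^sub>n, \<dots>, n k\<^sub>n\<close>. For the common point \<open>z\<close> of all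
  balls and \<open>s > m\<close>, the points \<open>T\<^sup>i\<^sup>k z\<close> with \<open>k = k\<^sub>s\<close> and \<open>i \<le> s\<close> are in \<open>B\<^sub>m\<^sub>+\<^sub>1\<close>, so each
  of the times \<open>i k\<^sub>s\<close> starts a progression of return times of step \<open>k\<^sub>m\<close> and length \<open>m + 1\<close>.
  As \<open>s\<close> is arbitrary, there are infinitely many of them.
\<close>

definition multiply_recurrent :: "('a::topological_space \<Rightarrow> 'a) \<Rightarrow> bool" where
  "multiply_recurrent T \<longleftrightarrow>
     (\<forall>U m. open U \<and> U \<noteq> {} \<longrightarrow> (\<exists>k\<ge>1. \<exists>y. \<forall>j\<le>m. (T ^^ (j * k)) y \<in> U))"

text \<open>
  A progression determines its first term, which is its least element; so infinitely many
  progressions of a given step and length amount to infinitely many first terms.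
\<close>

lemma AP_bar_iff_infinite_starts:
  "A \<in> AP_bar \<longleftrightarrow> (\<forall>m. \<exists>k\<ge>1. infinite {a. \<forall>j\<le>m. a + j * k \<in> A})"
proof -
  have "infinite {P. (\<exists>a. P = arith_prog a k m) \<and> P \<subseteq> A} \<longleftrightarrow> infinite {a. \<forall>j\<le>m. a + j * k \<in> A}"
    for k m
  proof -
    have "inj (\<lambda>a. arith_prog a k m)"
    proof (rule injI)
      fix a b
      assume eq: "arith_prog a k m = arith_prog b k m"
      have start: "c \<in> arith_prog c k m" for c
        unfolding arith_prog_def by (rule CollectI, rule exI[of _ 0]) simp
      have "a \<in> arith_prog b k m" "b \<in> arith_prog a k m"
        using start eq by auto
      then show "a = b"
        by (auto simp: arith_prog_def)
    qed
    moreover have "{P. (\<exists>a. P = arith_prog a k m) \<and> P \<subseteq> A}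
        = (\<lambda>a. arith_prog a k m) ` {a. \<forall>j\<le>m. a + j * k \<in> A}"
      by (auto simp: arith_prog_def)
    ultimately show ?thesis
      by (simp add: finite_image_iff inj_on_subset[OF _ subset_UNIV])
  qed
  then show ?thesis
    unfolding AP_bar_def by simp
qed

lemma continuous_on_funpow:
  fixes T :: "'a::topological_space \<Rightarrow> 'a"
  assumes "continuous_on UNIV T"
  shows "continuous_on UNIV (T ^^ n)"
proof (induction n)
  case 0
  then show ?case by (simp add: id_def)
next
  case (Suc n)
  then show ?case
    using continuous_on_compose2[OF assms Suc] by (simp add: comp_def)
qed

text \<open>
  Beyond multiple recurrence, one point has to work for all lengths and, for each length, with
  infinitely many starting times of the same step. The balls of the nested construction are
  indexed so that the \<open>n\<close>-th step takes care of length \<open>n + 1\<close>, and every later step produces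
  more starting times for it.
\<close>

lemma has_property_AP_bar_if_recurrent:
  fixes T :: "'a::topological_space \<Rightarrow> 'a"
  assumes cm: "completely_metrizable_space (euclidean :: 'a topology)"
    and cont: "continuous_on UNIV T"
    and rec: "multiply_recurrent T"
  shows "has_property AP_bar T"
  unfolding has_property_def seq_has_property_def
proof (intro allI impI)
  fix U :: "'a set"
  assume U: "open U \<and> U \<noteq> {}"
  obtain M d where "Metric_space M d" and compl: "Metric_space.mcomplete M d"
    and top: "(euclidean :: 'a topology) = Metric_space.mtopology M d"
    using cm unfolding completely_metrizable_space_def by blast
  then interpret Metric_space M d by simp
  have inM: "x \<in> M" for x
    using top topspace_mtopology by (metis topspace_euclidean UNIV_I)
  have op: "openin mtopology V \<longleftrightarrow> open V" for V
    by (simp flip: top)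
  have open_mball: "open (mball c r)" for c r
    using openin_mball op by blast
  have ball_in: "\<exists>c r. 0 < r \<and> r \<le> e \<and> mcball c r \<subseteq> V" if "open V" "V \<noteq> {}" "0 < e" for V e
  proof -
    obtain c where "c \<in> V"
      using \<open>V \<noteq> {}\<close> by blast
    then obtain r where "0 < r" "mcball c r \<subseteq> V"
      using \<open>open V\<close> op openin_mtopology_mcball by blast
    moreover have "mcball c (min r e) \<subseteq> mcball c r"
      by auto
    ultimately show ?thesis
      using \<open>0 < e\<close> by (metis min.cobounded2 min_less_iff_conj order_trans)
  qed
  define P :: "nat \<Rightarrow> 'a \<times> real \<Rightarrow> bool"
    where "P n b \<longleftrightarrow> 0 < snd b \<and> mcball (fst b) (snd b) \<subseteq> U" for n b
  define Q :: "nat \<Rightarrow> 'a \<times> real \<Rightarrow> 'a \<times> real \<Rightarrow> bool"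
    where "Q n b b' \<longleftrightarrow> snd b' \<le> inverse (real (Suc n)) \<and>
      (\<exists>k\<ge>1. \<forall>z \<in> mcball (fst b') (snd b'). \<forall>j\<le>n. (T ^^ (j * k)) z \<in> mball (fst b) (snd b))"
    for n b b'
  \<comment> \<open>A pair consists of a centre and a radius; multiple recurrence applies to the open balls,
    completeness to the closed ones.\<close>
  have "\<exists>f. \<forall>n. P n (f n) \<and> Q n (f n) (f (Suc n))"
  proof (rule dependent_nat_choice)
    show "\<exists>b. P 0 b"
      using ball_in[of U 1] U unfolding P_def by auto
  next
    fix b n
    assume Pb: "P n b"
    define B where "B = mball (fst b) (snd b)"
    have B: "open B" "B \<noteq> {}" "B \<subseteq> U"
      using Pb open_mball inM mball_subset_mcball unfolding B_def P_def
      by (blast, metis centre_in_mball_iff empty_iff, blast)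
    then obtain k y where k: "1 \<le> k" "\<forall>j\<le>n. (T ^^ (j * k)) y \<in> B"
      using rec unfolding multiply_recurrent_def by blast
    define W where "W = (\<Inter>j\<in>{..n}. (T ^^ (j * k)) -` B)"
    have "open W"
      unfolding W_def using continuous_on_funpow[OF cont] B(1)
      by (intro open_INT) (auto intro: open_vimage)
    moreover have "y \<in> W"
      using k unfolding W_def by auto
    ultimately obtain c r where cr: "0 < r" "r \<le> inverse (real (Suc n))" "mcball c r \<subseteq> W"
      using ball_in[of W "inverse (real (Suc n))"] by auto
    have "W \<subseteq> B"
      unfolding W_def by force
    have "P (Suc n) (c, r)"
      using cr \<open>W \<subseteq> B\<close> B(3) unfolding P_def by auto
    moreover have "\<forall>z \<in> mcball c r. \<forall>j\<le>n. (T ^^ (j * k)) z \<in> B"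
      using cr(3) unfolding W_def by blast
    then have "Q n b (c, r)"
      using cr(2) k(1) unfolding Q_def B_def by auto
    ultimately show "\<exists>b'. P (Suc n) b' \<and> Q n b b'"
      by blast
  qed
  then obtain f where f: "\<And>n. P n (f n)" "\<And>n. Q n (f n) (f (Suc n))"
    by blast
  define C where "C n = mcball (fst (f n)) (snd (f n))" for n
  have "\<forall>n. \<exists>k\<ge>1. \<forall>z \<in> C (Suc n). \<forall>j\<le>n. (T ^^ (j * k)) z \<in> mball (fst (f n)) (snd (f n))"
    using f(2) unfolding Q_def C_def by blast
  then obtain k where k1: "\<And>n. 1 \<le> k n"
    and k: "\<And>n z j. z \<in> C (Suc n) \<Longrightarrow> j \<le> n \<Longrightarrow> (T ^^ (j * k n)) z \<in> C n"
    unfolding C_def by (metis in_mono mball_subset_mcball)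
  have Csub: "C n \<subseteq> U" for n
    using f(1) unfolding P_def C_def by blast
  \<comment> \<open>The time \<open>j = 0\<close> makes the balls nested.\<close>
  have dec: "decseq C"
  proof (rule decseq_SucI)
    show "C (Suc n) \<subseteq> C n" for n
      using k[of _ n 0] by auto
  qed
  have ne: "C n \<noteq> {}" for n
    using f(1)[of n] inM unfolding P_def C_def by (simp add: mcball_eq_empty)
  have small: "\<exists>n a. C n \<subseteq> mcball a e" if "e > 0" for e
  proof -
    obtain n where "inverse (real (Suc n)) < e"
      using reals_Archimedean[OF \<open>e > 0\<close>] by blast
    then have "snd (f (Suc n)) \<le> e"
      using f(2)[of n] unfolding Q_def by linarith
    then have "C (Suc n) \<subseteq> mcball (fst (f (Suc n))) e"
      unfolding C_def by auto
    then show ?thesis by blast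
  qed
  have "\<Inter> (range C) \<noteq> {}"
  proof -
    have "\<forall>n. closedin mtopology (C n)"
      unfolding C_def by simp
    then show ?thesis
      using compl[unfolded mcomplete_nest, rule_format, of C] ne dec small by blast
  qed
  then obtain z where z: "\<And>n. z \<in> C n"
    by blast
  have "{n. (T ^^ n) z \<in> U} \<in> AP_bar"
    unfolding AP_bar_iff_infinite_starts
  proof
    fix m
    let ?S = "{a. \<forall>j\<le>m. a + j * k m \<in> {n. (T ^^ n) z \<in> U}}"
    have sub: "(\<lambda>i. i * k s) ` {..s} \<subseteq> ?S" if "m < s" for s
    proof clarify
      fix i j
      assume "i \<le> s" "j \<le> m"
      have "(T ^^ (i * k s)) z \<in> C s"
        using k z \<open>i \<le> s\<close> by blast
      then have "(T ^^ (i * k s)) z \<in> C (Suc m)"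
        using decseqD[OF dec, of "Suc m" s] \<open>m < s\<close> by auto
      then have "(T ^^ (j * k m)) ((T ^^ (i * k s)) z) \<in> U"
        using k \<open>j \<le> m\<close> Csub by blast
      then show "(T ^^ (i * k s + j * k m)) z \<in> U"
        by (simp add: add.commute[of "i * k s"] funpow_add)
    qed
    have "infinite ?S"
    proof
      assume fin: "finite ?S"
      define s where "s = m + card ?S + 1"
      have "inj_on (\<lambda>i. i * k s) {..s}"
        using k1[of s] by (auto intro!: inj_onI)
      then have "Suc s \<le> card ?S"
        using card_mono[OF fin sub[of s]] by (simp add: card_image s_def)
      then show False
        unfolding s_def by simp
    qed
    then show "\<exists>k\<ge>1. infinite {a. \<forall>j\<le>m. a + j * k \<in> {n. (T ^^ n) z \<in> U}}"
      using k1 by blast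
  qed
  then show "\<exists>x. {n. (T ^^ n) x \<in> U} \<in> AP_bar"
    by blast
qed

lemma ratio_at_multiple_shift_tendsto_1:
  fixes lam :: "nat \<Rightarrow> 'a::real_normed_field"
  assumes nz: "\<And>n. lam n \<noteq> 0"
    and lim: "(\<lambda>n. lam (n + \<tau>) / lam n) \<longlonglongrightarrow> 1"
  shows "(\<lambda>n. lam n / lam (n + i * \<tau>)) \<longlonglongrightarrow> 1"
proof -
  have "(\<lambda>n. lam (n + i * \<tau>) / lam n) \<longlonglongrightarrow> 1"
  proof (induction i)
    case 0
    then show ?case using nz by simp
  next
    case (Suc i)
    have "(\<lambda>n. lam ((n + i * \<tau>) + \<tau>) / lam (n + i * \<tau>)) \<longlonglongrightarrow> 1"
      by (rule LIMSEQ_ignore_initial_segment[OF lim])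
    from tendsto_mult[OF this Suc] show ?case
      using nz by (simp add: algebra_simps)
  qed
  from tendsto_inverse[OF this] show ?thesis
    by simp
qed

lemma (in vector_space) funpow_scale:
  assumes "Vector_Spaces.linear scale scale T"
  shows "(T ^^ n) (scale c x) = scale c ((T ^^ n) x)"
  using assms by (induction n) (simp_all add: Vector_Spaces.linear_iff)

text \<open>
  Only the multiples of \<open>\<tau>\<close> are usable as steps, since the ratios \<open>\<lambda>\<^sub>n / \<lambda>\<^sub>n\<^sub>+\<^sub>q\<close> are under control
  only for these \<open>q\<close>. A progression of length \<open>m\<tau> + 1\<close> and step \<open>k\<close> contains one of length \<open>m + 1\<close>
  and step \<open>\<tau>k\<close>.
\<close>

lemma multiply_recurrent_of_weighted_powers:
  fixes smul :: "complex \<Rightarrow> 'a::topological_ab_group_add \<Rightarrow> 'a"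
  assumes vs: "vector_space smul"
    and cont_smul: "continuous_on UNIV (\<lambda>(c, x). smul c x)"
    and lin: "Vector_Spaces.linear smul smul T"
    and nz: "\<And>n. lam n \<noteq> 0"
    and tau: "\<tau> \<ge> 1"
    and lim: "(\<lambda>n. lam (n + \<tau>) / lam n) \<longlonglongrightarrow> 1"
    and AP: "seq_has_property AP_bar (\<lambda>n x. smul (lam n) ((T ^^ n) x))"
  shows "multiply_recurrent T"
  unfolding multiply_recurrent_def
proof (intro allI impI)
  interpret vector_space smul by (rule vs)
  fix U :: "'a set" and m :: nat
  assume U: "open U \<and> U \<noteq> {}"
  then obtain u where "u \<in> U" by blast
  have "open ((\<lambda>(c, x). smul c x) -` U)"
    using cont_smul U by (auto intro: open_vimage)
  moreover have "(1, u) \<in> (\<lambda>(c, x). smul c x) -` U"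
    using \<open>u \<in> U\<close> by simp
  ultimately obtain A B where AB: "open A" "open B" "(1, u) \<in> A \<times> B"
    "A \<times> B \<subseteq> (\<lambda>(c, x). smul c x) -` U"
    by (rule open_prod_elim)
  obtain x where "{n. smul (lam n) ((T ^^ n) x) \<in> B} \<in> AP_bar"
    using AP AB unfolding seq_has_property_def by blast
  then obtain k where k: "1 \<le> k"
    and inf: "infinite {a. \<forall>j\<le>m * \<tau>. smul (lam (a + j * k)) ((T ^^ (a + j * k)) x) \<in> B}"
    unfolding AP_bar_iff_infinite_starts mem_Collect_eq by meson
  have "eventually (\<lambda>a. \<forall>j\<in>{..m}. lam a / lam (a + (j * k) * \<tau>) \<in> A) sequentially"
    using ratio_at_multiple_shift_tendsto_1[OF nz lim] AB(1,3)
    by (intro eventually_ball_finite) (auto simp: tendsto_def)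
  then obtain N where N: "\<And>a j. N \<le> a \<Longrightarrow> j \<le> m \<Longrightarrow> lam a / lam (a + (j * k) * \<tau>) \<in> A"
    unfolding eventually_sequentially by auto
  obtain a where a: "N \<le> a"
    "\<And>j. j \<le> m * \<tau> \<Longrightarrow> smul (lam (a + j * k)) ((T ^^ (a + j * k)) x) \<in> B"
    using inf unfolding infinite_nat_iff_unbounded_le by blast
  define y where "y = smul (lam a) ((T ^^ a) x)"
  have "(T ^^ (j * (k * \<tau>))) y \<in> U" if "j \<le> m" for j
  proof -
    let ?n = "a + (j * k) * \<tau>"
    have n: "?n = a + (j * \<tau>) * k"
      by (simp add: ac_simps)
    have "smul (lam ?n) ((T ^^ ?n) x) \<in> B"
      using a(2)[of "j * \<tau>"] \<open>j \<le> m\<close> unfolding n by simp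
    then have "smul (lam a / lam ?n) (smul (lam ?n) ((T ^^ ?n) x)) \<in> U"
      using AB(4) N[OF a(1) \<open>j \<le> m\<close>] by auto
    moreover have "(T ^^ (j * (k * \<tau>))) y = smul (lam a) ((T ^^ ?n) x)"
      unfolding y_def funpow_scale[OF lin]
      by (simp add: funpow_add add.commute[of a] mult.assoc)
    ultimately show ?thesis
      using nz by simp
  qed
  moreover have "1 \<le> k * \<tau>"
    using k tau by simp
  ultimately show "\<exists>k\<ge>1. \<exists>y. \<forall>j\<le>m. (T ^^ (j * k)) y \<in> U"
    by blast
qed

theorem corollary5p5:
  fixes smul :: "complex \<Rightarrow> 'a::topological_ab_group_add \<Rightarrow> 'a"
    and T :: "'a \<Rightarrow> 'a"
    and lam :: "nat \<Rightarrow> complex"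
    and \<tau> :: nat
  assumes "complex_frechet_space smul"
    and "Vector_Spaces.linear smul smul T"
    and "continuous_on UNIV T"
    and "\<And>n. lam n \<noteq> 0"
    and "\<tau> \<ge> 1"
    and "(\<lambda>n. lam (n + \<tau>) / lam n) \<longlonglongrightarrow> 1"
    and "seq_has_property AP_bar (\<lambda>n x. smul (lam n) ((T ^^ n) x))"
  shows "has_property AP_bar T"
proof (rule has_property_AP_bar_if_recurrent)
  interpret complex_frechet_space smul by (rule assms(1))
  obtain d where "Metric_space (UNIV :: 'a set) d" "Metric_space.mcomplete (UNIV :: 'a set) d"
    "Metric_space.mtopology (UNIV :: 'a set) d = euclidean"
    using complete_invariant_metric by (elim exE conjE)
  then show "completely_metrizable_space (euclidean :: 'a topology)"
    unfolding completely_metrizable_space_def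
    by (intro exI[of _ UNIV] exI[of _ d]) simp
  show "continuous_on UNIV T"
    by (rule assms(3))
  show "multiply_recurrent T"
    by (rule multiply_recurrent_of_weighted_powers
        [OF vector_space_axioms continuous_smul assms(2,4,5,6,7)])
qed

end
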